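(* Let $\mathbf{D}$ be a D-core algebra and $x,y,z\in D$. Then (a) $x\sqcap(y\sqcap z)=(x\sqcap y)\sqcap z$ and (b) $x\sqcup(y\sqcup z)=(x\sqcup y)\sqcup z$.
   Context: Write $x\vee y:=\neg(\neg x\sqcap\neg y)$ and $x\wedge y:=\lrcorner(\lrcorner x\sqcup\lrcorner y)$. A D-core algebra is an algebra $(D;\sqcap,\sqcup,\neg,\lrcorner,\top,\bot)$ of type $(2,2,1,1,0,0)$ satisfying, for all $x,y,z\in D$: $x\sqcap y=y\sqcap x$; $x\sqcup y=y\sqcup x$; $\neg(x\sqcap x)=\neg x$; $\lrcorner(x\sqcup x)=\lrcorner x$; $x\sqcap(x\sqcup y)=x\sqcap x$; $x\sqcup(x\sqcap y)=x\sqcup x$; $x\sqcap(y\vee z)=(x\sqcap y)\vee(x\sqcap z)$; $x\sqcup(y\wedge z)=(x\sqcup y)\wedge(x\sqcup z)$; $\neg\neg(x\sqcap y)=x\sqcap y$; $\lrcorner\lrcorner(x\sqcup y)=x\sqcup y$; $x\sqcap\neg x=\bot$; $x\sqcup\lrcorner x=\top$; $(x\sqcap x)\sqcup(x\sqcap x)=(x\sqcup x)\sqcap(x\sqcup x)$. *)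

theory Defs
  imports Main
begin

text \<open>
  The carrier \<open>D\<close> is the whole type \<open>'a\<close>. The two unary operations of the signature are \<open>neg\<close>
  (the operation usually written \<open>\<not>\<close>, paired with \<open>\<sqinter>\<close>) and \<open>opp\<close> (the operation usually
  written as a lower right corner, paired with \<open>\<squnion>\<close>). The operations \<open>vee\<close> and \<open>wedge\<close> are
  derived and differ in general from \<open>\<squnion>\<close> and \<open>\<sqinter>\<close>.
\<close>

locale dcore_signature =
  fixes meet :: "'a \<Rightarrow> 'a \<Rightarrow> 'a"  (infixl "\<sqinter>" 70)
    and join :: "'a \<Rightarrow> 'a \<Rightarrow> 'a"  (infixl "\<squnion>" 65)
    and neg :: "'a \<Rightarrow> 'a"
    and opp :: "'a \<Rightarrow> 'a"
    and top_elem :: 'a  ("\<top>")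
    and bot_elem :: 'a  ("\<bottom>")
begin

definition vee :: "'a \<Rightarrow> 'a \<Rightarrow> 'a"
  where "vee x y = neg (neg x \<sqinter> neg y)"

definition wedge :: "'a \<Rightarrow> 'a \<Rightarrow> 'a"
  where "wedge x y = opp (opp x \<squnion> opp y)"

end

locale dcore_algebra = dcore_signature +
  assumes meet_commute: "x \<sqinter> y = y \<sqinter> x"
    and join_commute: "x \<squnion> y = y \<squnion> x"
    and neg_meet_self: "neg (x \<sqinter> x) = neg x"
    and opp_join_self: "opp (x \<squnion> x) = opp x"
    and meet_absorb: "x \<sqinter> (x \<squnion> y) = x \<sqinter> x"
    and join_absorb: "x \<squnion> (x \<sqinter> y) = x \<squnion> x"
    and meet_vee_distrib: "x \<sqinter> vee y z = vee (x \<sqinter> y) (x \<sqinter> z)"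
    and join_wedge_distrib: "x \<squnion> wedge y z = wedge (x \<squnion> y) (x \<squnion> z)"
    and neg_neg_meet: "neg (neg (x \<sqinter> y)) = x \<sqinter> y"
    and opp_opp_join: "opp (opp (x \<squnion> y)) = x \<squnion> y"
    and meet_neg: "x \<sqinter> neg x = \<bottom>"
    and join_opp: "x \<squnion> opp x = \<top>"
    and meet_join_self: "(x \<sqinter> x) \<squnion> (x \<sqinter> x) = (x \<squnion> x) \<sqinter> (x \<squnion> x)"

end

(*
  Absorption gives x \<sqinter> \<top> = x \<sqinter> (x \<squnion> opp x) = x \<sqinter> x, so the elements x \<sqinter> x with
  \<sqinter>, vee and neg satisfy Huntington's axioms for a Boolean algebra, and x \<sqinter> y depends only
  on x \<sqinter> x and y \<sqinter> y. Huntington's argument then yields associativity: both bracketings have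
  the same vee with x and the same vee with neg x. The axioms are self-dual, which settles \<squnion>.
*)
theory Submission
  imports Defs
begin

text \<open>Phrased with one binary operation so that both \<open>\<sqinter>\<close> and
  \<open>\<squnion>\<close> are instances and associativity is proved once; \<open>meet_top\<close>
  keeps what absorption by the other operation contributes.\<close>

locale huntington_half =
  fixes meet :: "'a \<Rightarrow> 'a \<Rightarrow> 'a"  (infixl "\<sqinter>" 70)
    and neg :: "'a \<Rightarrow> 'a"
    and bot_elem :: 'a  ("\<bottom>")
    and top_elem :: 'a  ("\<top>")
  assumes meet_commute: "x \<sqinter> y = y \<sqinter> x"
    and neg_meet_self: "neg (x \<sqinter> x) = neg x"
    and distrib: "x \<sqinter> neg (neg y \<sqinter> neg z) = neg (neg (x \<sqinter> y) \<sqinter> neg (x \<sqinter> z))"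
    and neg_neg_meet: "neg (neg (x \<sqinter> y)) = x \<sqinter> y"
    and meet_neg: "x \<sqinter> neg x = \<bottom>"
    and meet_top: "x \<sqinter> \<top> = x \<sqinter> x"
begin

definition vee :: "'a \<Rightarrow> 'a \<Rightarrow> 'a"  (infixl "\<^bold>\<or>" 65)
  where "x \<^bold>\<or> y = neg (neg x \<sqinter> neg y)"

lemma meet_vee: "x \<sqinter> (y \<^bold>\<or> z) = (x \<sqinter> y) \<^bold>\<or> (x \<sqinter> z)"
  by (simp add: vee_def distrib)

lemma vee_commute: "x \<^bold>\<or> y = y \<^bold>\<or> x"
  by (simp add: vee_def meet_commute)

lemma neg_neg: "neg (neg x) = x \<sqinter> x"
  by (metis neg_meet_self neg_neg_meet)

lemma meet_idem_meet: "(x \<sqinter> y) \<sqinter> (x \<sqinter> y) = x \<sqinter> y"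
  by (metis neg_neg neg_neg_meet)

lemma neg_idem: "neg x \<sqinter> neg x = neg x"
  by (metis neg_neg neg_meet_self)

lemma vee_self: "x \<^bold>\<or> x = x \<sqinter> x"
  by (simp add: vee_def neg_idem neg_neg)

text \<open>Read \<open>y \<sqinter> y\<close> as \<open>vee y y\<close> and distribute: the result
  is the square of \<open>x \<sqinter> y\<close>, and meets equal their own squares.\<close>

lemma meet_square_right: "x \<sqinter> (y \<sqinter> y) = x \<sqinter> y"
  by (metis meet_vee vee_self meet_idem_meet)

lemma meet_square_left: "(x \<sqinter> x) \<sqinter> y = x \<sqinter> y"
  by (metis meet_square_right meet_commute)

lemma vee_square_left: "(x \<sqinter> x) \<^bold>\<or> y = x \<^bold>\<or> y"
  by (simp add: vee_def neg_meet_self)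

lemma vee_idem: "(x \<^bold>\<or> y) \<sqinter> (x \<^bold>\<or> y) = x \<^bold>\<or> y"
  by (simp add: vee_def neg_idem)

lemma neg_meet: "neg (x \<sqinter> y) = neg x \<^bold>\<or> neg y"
  by (simp add: vee_def neg_neg meet_square_left meet_square_right)

lemma neg_vee: "neg (x \<^bold>\<or> y) = neg x \<sqinter> neg y"
  by (simp add: vee_def neg_neg_meet)

text \<open>The De Morgan dual of \<open>meet_vee\<close>.\<close>

lemma vee_meet: "x \<^bold>\<or> (y \<sqinter> z) = (x \<^bold>\<or> y) \<sqinter> (x \<^bold>\<or> z)"
proof -
  have "x \<^bold>\<or> (y \<sqinter> z) = neg ((neg x \<sqinter> neg y) \<^bold>\<or> (neg x \<sqinter> neg z))"
    by (simp add: vee_def [of x] neg_meet [of y] meet_vee)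
  then show ?thesis
    by (simp add: neg_vee vee_def [of x])
qed

lemma neg_top: "neg \<top> = \<bottom>"
  by (metis meet_top neg_idem meet_neg meet_commute)

lemma vee_neg: "x \<^bold>\<or> neg x = \<top> \<sqinter> \<top>"
  by (metis vee_def meet_neg neg_top neg_neg)

lemma vee_bot: "x \<^bold>\<or> \<bottom> = x \<sqinter> x"
  by (metis vee_def neg_top neg_neg meet_square_right meet_top neg_idem)

lemma vee_top: "x \<^bold>\<or> \<top> = \<top> \<sqinter> \<top>"
proof -
  \<comment> \<open>The inserted factor is \<open>\<top> \<sqinter> \<top>\<close>, neutral on
    values of \<open>vee\<close>; it allows \<open>x\<close> to be factored out, leaving
    \<open>neg x \<sqinter> \<top> = neg x\<close>.\<close>
  have "x \<^bold>\<or> \<top> = (x \<^bold>\<or> neg x) \<sqinter> (x \<^bold>\<or> \<top>)"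
    by (metis vee_neg meet_square_left meet_commute meet_top vee_idem)
  also have "\<dots> = x \<^bold>\<or> neg x"
    by (metis vee_meet meet_top neg_idem)
  finally show ?thesis by (simp add: vee_neg)
qed

lemma vee_absorb: "x \<^bold>\<or> (x \<sqinter> y) = x \<sqinter> x"
proof -
  \<comment> \<open>Under \<open>vee\<close>, \<open>x\<close> may be replaced by
    \<open>x \<sqinter> x = x \<sqinter> \<top>\<close>; then \<open>x\<close> factors out.\<close>
  have "x \<^bold>\<or> (x \<sqinter> y) = x \<sqinter> (\<top> \<^bold>\<or> y)"
    by (simp add: meet_vee meet_top vee_square_left)
  then show ?thesis
    by (metis vee_commute vee_top meet_square_right meet_top)
qed

lemma meet_absorb: "x \<sqinter> (x \<^bold>\<or> y) = x \<sqinter> x"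
  by (simp add: meet_vee vee_square_left vee_absorb)

lemma neg_vee_meet: "neg x \<^bold>\<or> (x \<sqinter> y) = neg x \<^bold>\<or> y"
proof -
  have "neg x \<^bold>\<or> (x \<sqinter> y) = (\<top> \<sqinter> \<top>) \<sqinter> (neg x \<^bold>\<or> y)"
    by (simp add: vee_meet vee_commute [of "neg x" x] vee_neg)
  then show ?thesis
    by (metis meet_square_left meet_commute meet_top vee_idem)
qed

text \<open>Up to squaring, \<open>a\<close> is \<open>vee a \<bottom>\<close> with
  \<open>\<bottom> = x \<sqinter> neg x\<close>, which distributes into the meet of
  \<open>vee a x\<close> and \<open>vee a (neg x)\<close>.\<close>

lemma meet_cancel_by_cases:
  assumes "x \<^bold>\<or> a = x \<^bold>\<or> b" and "neg x \<^bold>\<or> a = neg x \<^bold>\<or> b"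
  shows "a \<sqinter> a = b \<sqinter> b"
  by (metis assms vee_commute vee_bot vee_meet meet_neg)

lemma meet_assoc: "x \<sqinter> (y \<sqinter> z) = (x \<sqinter> y) \<sqinter> z"
proof -
  \<comment> \<open>Both sides collapse to \<open>x \<sqinter> x\<close> by absorption.\<close>
  have "x \<^bold>\<or> (x \<sqinter> (y \<sqinter> z)) = x \<^bold>\<or> ((x \<sqinter> y) \<sqinter> z)"
    by (simp add: vee_absorb vee_meet [of x "x \<sqinter> y" z] meet_square_left meet_absorb)
  \<comment> \<open>Both sides become the meet of \<open>vee (neg x) y\<close> and
    \<open>vee (neg x) z\<close>.\<close>
  moreover have "neg x \<^bold>\<or> (x \<sqinter> (y \<sqinter> z)) = neg x \<^bold>\<or> ((x \<sqinter> y) \<sqinter> z)"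
    by (simp add: neg_vee_meet vee_meet [of "neg x" "x \<sqinter> y" z] vee_meet [of "neg x" y z])
  \<comment> \<open>Cancellation equates only the squares, but both bracketings are meets and so
    equal their squares.\<close>
  ultimately show ?thesis
    by (metis meet_cancel_by_cases meet_idem_meet)
qed

end

context dcore_algebra
begin

lemma huntington_half_meet: "huntington_half meet neg bot_elem top_elem"
proof
  show "x \<sqinter> \<top> = x \<sqinter> x" for x
    by (metis join_opp meet_absorb)
  show "x \<sqinter> neg (neg y \<sqinter> neg z) = neg (neg (x \<sqinter> y) \<sqinter> neg (x \<sqinter> z))" for x y z
    using meet_vee_distrib by (simp add: vee_def)
qed (fact meet_commute neg_meet_self neg_neg_meet meet_neg)+

lemma huntington_half_join: "huntington_half join opp top_elem bot_elem"
proof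
  \<comment> \<open>Here \<open>\<bottom>\<close> plays the part of \<open>\<top>\<close>: write it
    as \<open>x \<sqinter> neg x\<close> and absorb.\<close>
  show "x \<squnion> \<bottom> = x \<squnion> x" for x
    by (metis meet_neg join_absorb)
  show "x \<squnion> opp (opp y \<squnion> opp z) = opp (opp (x \<squnion> y) \<squnion> opp (x \<squnion> z))" for x y z
    using join_wedge_distrib by (simp add: wedge_def)
qed (fact join_commute opp_join_self opp_opp_join join_opp)+

end

theorem theorem3p12:
  fixes meet :: "'a \<Rightarrow> 'a \<Rightarrow> 'a"  (infixl "\<sqinter>" 70)
    and join :: "'a \<Rightarrow> 'a \<Rightarrow> 'a"  (infixl "\<squnion>" 65)
    and neg opp :: "'a \<Rightarrow> 'a"
    and top_elem bot_elem :: 'a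
    and x y z :: 'a
  assumes "dcore_algebra meet join neg opp top_elem bot_elem"
  shows "x \<sqinter> (y \<sqinter> z) = (x \<sqinter> y) \<sqinter> z \<and> x \<squnion> (y \<squnion> z) = (x \<squnion> y) \<squnion> z"
  using huntington_half.meet_assoc [OF dcore_algebra.huntington_half_meet [OF assms]]
    huntington_half.meet_assoc [OF dcore_algebra.huntington_half_join [OF assms]]
  by blast

end
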